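(* Let $p_4=1$ and $\rho>0$, and consider the system $$\mathcal{D}'=0,\qquad\mathcal{R}'=-2p_4\rho\,\mathcal{I},\qquad\mathcal{I}'=2p_4\rho\,\mathcal{R}$$ on $S^2_\rho$. The two points $(\mathcal{D},\mathcal{R},\mathcal{I})=\pm(\rho,0,0)$ are fixed points. Moreover, the solution is given by $$\mathcal{D}(\tau)=\mathcal{D}(0),\qquad\mathcal{R}(\tau)=\mathcal{R}(0)\cos(2p_4\rho\tau)-\mathcal{I}(0)\sin(2p_4\rho\tau),\qquad\mathcal{I}(\tau)=\mathcal{R}(0)\sin(2p_4\rho\tau)+\mathcal{I}(0)\cos(2p_4\rho\tau).$$
   Context: $S^2_\rho=\{(x,y,z)\in\mathbb{R}^3: x^2+y^2+z^2=\rho^2\}$; the unknown $(\mathcal{D},\mathcal{R},\mathcal{I})$ is real valued with initial data in $S_\rho^2$, $\tau\in\mathbb{R}$, and the system preserves $S^2_\rho$. *)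

theory Defs
  imports "HOL-Analysis.Analysis"
begin

definition sphere2 :: "real \<Rightarrow> (real \<times> real \<times> real) set" where
  "sphere2 \<rho> = {(x, y, z). x\<^sup>2 + y\<^sup>2 + z\<^sup>2 = \<rho>\<^sup>2}"

definition rotation_field :: "real \<Rightarrow> real \<Rightarrow> real \<times> real \<times> real \<Rightarrow> real \<times> real \<times> real" where
  "rotation_field p\<^sub>4 \<rho> = (\<lambda>(D, R, I). (0, - 2 * p\<^sub>4 * \<rho> * I, 2 * p\<^sub>4 * \<rho> * R))"

text \<open>Solutions are global in time, i.e. defined and differentiable on all of \<open>\<real>\<close>. That they stay
  in the phase space is not part of the definition.\<close>

definition is_solution :: "('a::real_normed_vector \<Rightarrow> 'a) \<Rightarrow> (real \<Rightarrow> 'a) \<Rightarrow> bool" where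
  "is_solution F u \<longleftrightarrow> (\<forall>\<tau>. (u has_vector_derivative F (u \<tau>)) (at \<tau>))"

definition fixed_point_on :: "'a set \<Rightarrow> ('a::real_normed_vector \<Rightarrow> 'a) \<Rightarrow> 'a \<Rightarrow> bool" where
  "fixed_point_on S F x \<longleftrightarrow> x \<in> S \<and> F x = 0"

end

theory Submission
  imports Defs
begin

text \<open>The coordinates of \<open>(\<R>, \<I>)\<close> in the frame rotating with angular velocity
  \<open>2 p\<^sub>4 \<rho>\<close> are conserved along solutions; rotating back gives the explicit formula, and
  rotations preserve \<open>\<R>\<^sup>2 + \<I>\<^sup>2\<close>.\<close>

text \<open>The projections \<open>fst\<close> and \<open>snd\<close> are bounded linear, so they
  commute with differentiation; this gives the direction from the pair to its components.\<close>

lemma has_vector_derivative_Pair_iff: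
  fixes f :: "real \<Rightarrow> 'a::real_normed_vector" and g :: "real \<Rightarrow> 'b::real_normed_vector"
  shows "((\<lambda>x. (f x, g x)) has_vector_derivative (f', g')) (at t within S) \<longleftrightarrow>
    (f has_vector_derivative f') (at t within S) \<and> (g has_vector_derivative g') (at t within S)"
  using bounded_linear.has_vector_derivative[OF bounded_linear_fst, of "\<lambda>x. (f x, g x)" "(f', g')" "at t within S"]
    bounded_linear.has_vector_derivative[OF bounded_linear_snd, of "\<lambda>x. (f x, g x)" "(f', g')" "at t within S"]
  by (auto intro: has_vector_derivative_Pair)

text \<open>Passing to scalar equations makes the calculus of real derivatives available, in
  particular constancy of functions with zero derivative.\<close>

lemma is_solution_rotation_field_iff:
  "is_solution (rotation_field p \<rho>) (\<lambda>\<tau>. (D \<tau>, R \<tau>, I \<tau>)) \<longleftrightarrow>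
    (\<forall>\<tau>. (D has_real_derivative 0) (at \<tau>) \<and>
      (R has_real_derivative - (2 * p * \<rho> * I \<tau>)) (at \<tau>) \<and>
      (I has_real_derivative 2 * p * \<rho> * R \<tau>) (at \<tau>))"
  by (simp add: is_solution_def rotation_field_def has_vector_derivative_Pair_iff
      has_real_derivative_iff_has_vector_derivative)

text \<open>With z = R + iI the system reads z' = i \<omega> z, so exp(-i \<omega> t) z(t) has zero
  derivative and equals z(0).\<close>

lemma harmonic_system_unique:
  fixes \<omega> :: real
  assumes R: "\<And>\<tau>. (R has_real_derivative - (\<omega> * I \<tau>)) (at \<tau>)"
    and I: "\<And>\<tau>. (I has_real_derivative \<omega> * R \<tau>) (at \<tau>)"
  shows "R \<tau> = R 0 * cos (\<omega> * \<tau>) - I 0 * sin (\<omega> * \<tau>)"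
    and "I \<tau> = R 0 * sin (\<omega> * \<tau>) + I 0 * cos (\<omega> * \<tau>)"
proof -
  let ?c = "cos (\<omega> * \<tau>)" and ?s = "sin (\<omega> * \<tau>)"
  \<comment> \<open>This is the real part of exp(-i \<omega> t) z(t); the imaginary part follows
    below.\<close>
  have "((\<lambda>t. R t * cos (\<omega> * t) + I t * sin (\<omega> * t)) has_real_derivative 0) (at t)" for t
    by (auto intro!: derivative_eq_intros R I simp: algebra_simps)
  from DERIV_isconst_all[OF allI, OF this, of \<tau> 0]
  have A: "R 0 = R \<tau> * ?c + I \<tau> * ?s" by simp
  have "((\<lambda>t. I t * cos (\<omega> * t) - R t * sin (\<omega> * t)) has_real_derivative 0) (at t)" for t
    by (auto intro!: derivative_eq_intros R I simp: algebra_simps)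
  from DERIV_isconst_all[OF allI, OF this, of \<tau> 0]
  have B: "I 0 = I \<tau> * ?c - R \<tau> * ?s" by simp
  \<comment> \<open>Rotating back by the angle \<omega> \<tau>: keeping the factor
    \<open>?s\<^sup>2 + ?c\<^sup>2\<close> leaves a polynomial identity for \<open>algebra\<close>,
    and \<open>simp\<close> then replaces the factor by 1.\<close>
  have "R 0 * ?c - I 0 * ?s = R \<tau> * (?s\<^sup>2 + ?c\<^sup>2)"
    unfolding A B by algebra
  then show "R \<tau> = R 0 * ?c - I 0 * ?s" by simp
  have "R 0 * ?s + I 0 * ?c = I \<tau> * (?s\<^sup>2 + ?c\<^sup>2)"
    unfolding A B by algebra
  then show "I \<tau> = R 0 * ?s + I 0 * ?c" by simp
qed

text \<open>Left to right is uniqueness, by the conserved quantities; right to left is existence, by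
  differentiating the formula.\<close>

lemma rotation_field_solution_formula:
  "is_solution (rotation_field p \<rho>) (\<lambda>\<tau>. (D \<tau>, R \<tau>, I \<tau>)) \<and>
      (D 0, R 0, I 0) = (D\<^sub>0, R\<^sub>0, I\<^sub>0) \<longleftrightarrow>
    (\<forall>\<tau>. D \<tau> = D\<^sub>0 \<and>
      R \<tau> = R\<^sub>0 * cos (2 * p * \<rho> * \<tau>) - I\<^sub>0 * sin (2 * p * \<rho> * \<tau>) \<and>
      I \<tau> = R\<^sub>0 * sin (2 * p * \<rho> * \<tau>) + I\<^sub>0 * cos (2 * p * \<rho> * \<tau>))" (is "?sol \<longleftrightarrow> ?formula")
proof
  assume sol: ?sol
  then have "D \<tau> = D 0" for \<tau>
    unfolding is_solution_rotation_field_iff using DERIV_isconst_all by blast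
  with sol harmonic_system_unique[of R "2 * p * \<rho>" I] show ?formula
    by (simp add: is_solution_rotation_field_iff)
next
  assume formula: ?formula
  \<comment> \<open>Equations between functions, rather than between values, allow rewriting under
    the derivative.\<close>
  then have "D = (\<lambda>\<tau>. D\<^sub>0)"
    and "R = (\<lambda>\<tau>. R\<^sub>0 * cos (2 * p * \<rho> * \<tau>) - I\<^sub>0 * sin (2 * p * \<rho> * \<tau>))"
    and "I = (\<lambda>\<tau>. R\<^sub>0 * sin (2 * p * \<rho> * \<tau>) + I\<^sub>0 * cos (2 * p * \<rho> * \<tau>))"
    by blast+
  then show ?sol
    by (auto simp: is_solution_rotation_field_iff algebra_simps intro!: derivative_eq_intros)
qed

text \<open>Here \<rho> enters only through the angular velocity, so the radius \<open>r\<close> is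
  arbitrary: the flow rotates about the first axis and preserves every sphere centred at the
  origin.\<close>

lemma rotation_field_preserves_sphere2:
  assumes "is_solution (rotation_field p \<rho>) u" and "u 0 \<in> sphere2 r"
  shows "u \<tau> \<in> sphere2 r"
proof -
  define D R I where "D = (\<lambda>t. fst (u t))" and "R = (\<lambda>t. fst (snd (u t)))"
    and "I = (\<lambda>t. snd (snd (u t)))"
  have u: "u = (\<lambda>t. (D t, R t, I t))"
    by (simp add: D_def R_def I_def)
  let ?c = "cos (2 * p * \<rho> * \<tau>)" and ?s = "sin (2 * p * \<rho> * \<tau>)"
  have D: "D \<tau> = D 0" and R: "R \<tau> = R 0 * ?c - I 0 * ?s" and I: "I \<tau> = R 0 * ?s + I 0 * ?c"
    using rotation_field_solution_formula[of p \<rho> D R I "D 0" "R 0" "I 0"] assms(1)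
    unfolding u by blast+
  have "(R \<tau>)\<^sup>2 + (I \<tau>)\<^sup>2 = ((R 0)\<^sup>2 + (I 0)\<^sup>2) * (?s\<^sup>2 + ?c\<^sup>2)"
    unfolding R I by algebra
  with assms(2) D show ?thesis
    by (simp add: u sphere2_def add.assoc)
qed

theorem proposition2p7:
  fixes p\<^sub>4 \<rho> :: real
  assumes "p\<^sub>4 = 1" and "\<rho> > 0"
  shows "fixed_point_on (sphere2 \<rho>) (rotation_field p\<^sub>4 \<rho>) (\<rho>, 0, 0) \<and>
    fixed_point_on (sphere2 \<rho>) (rotation_field p\<^sub>4 \<rho>) (- (\<rho>, 0, 0)) \<and>
    (\<forall>D\<^sub>0 R\<^sub>0 I\<^sub>0. (D\<^sub>0, R\<^sub>0, I\<^sub>0) \<in> sphere2 \<rho> \<longrightarrow>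
      (\<forall>D R I :: real \<Rightarrow> real.
        (is_solution (rotation_field p\<^sub>4 \<rho>) (\<lambda>\<tau>. (D \<tau>, R \<tau>, I \<tau>)) \<and>
          (D 0, R 0, I 0) = (D\<^sub>0, R\<^sub>0, I\<^sub>0)) \<longleftrightarrow>
        (\<forall>\<tau>. D \<tau> = D\<^sub>0 \<and>
             R \<tau> = R\<^sub>0 * cos (2 * p\<^sub>4 * \<rho> * \<tau>) - I\<^sub>0 * sin (2 * p\<^sub>4 * \<rho> * \<tau>) \<and>
             I \<tau> = R\<^sub>0 * sin (2 * p\<^sub>4 * \<rho> * \<tau>) + I\<^sub>0 * cos (2 * p\<^sub>4 * \<rho> * \<tau>)))) \<and>
    (\<forall>u. is_solution (rotation_field p\<^sub>4 \<rho>) u \<and> u 0 \<in> sphere2 \<rho> \<longrightarrow> (\<forall>\<tau>. u \<tau> \<in> sphere2 \<rho>))"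
proof (intro conjI allI impI rotation_field_solution_formula)
  \<comment> \<open>The solution formula, used as an introduction rule, has closed the equivalence;
    the fixed points and the invariance of the sphere remain.\<close>
  show "fixed_point_on (sphere2 \<rho>) (rotation_field p\<^sub>4 \<rho>) (\<rho>, 0, 0)"
    and "fixed_point_on (sphere2 \<rho>) (rotation_field p\<^sub>4 \<rho>) (- (\<rho>, 0, 0))"
    by (simp_all add: fixed_point_on_def sphere2_def rotation_field_def zero_prod_def)
qed (blast intro: rotation_field_preserves_sphere2)

end
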